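(* Let $I\subseteq(0,\infty)$ be an interval, let $f:I\to\mathbb{R}$ be differentiable on the interior $I^{\circ}$ of $I$, let $a,b\in I^{\circ}$ with $a<b$, and let $h:[a,b]\to[0,\infty)$ be differentiable. Put $G=\sqrt{ab}$. If $|f'|$ is GA-convex on $[a,b]$, then $$\left|\left[h(b)-2h(a)\right]\frac{f(a)}{2}+h(b)\frac{f(b)}{2}-\int_a^b f(x)h'(x)\,dx\right|\le\frac{\ln b-\ln a}{4}\Big[\zeta_1(a,b)|f'(a)|+\zeta_2(a,b)|f'(G)|+\zeta_3(a,b)|f'(b)|\Big],$$ where $$\zeta_1(a,b)=\int_0^1 t\,a^tG^{1-t}\left|2h\left(a^tG^{1-t}\right)-h(b)\right|dt,$$ $$\zeta_2(a,b)=\int_0^1(1-t)a^tG^{1-t}\left|2h\left(a^tG^{1-t}\right)-h(b)\right|dt+\int_0^1(1-t)b^tG^{1-t}\left|2h\left(b^tG^{1-t}\right)-h(b)\right|dt,$$ $$\zeta_3(a,b)=\int_0^1 t\,b^tG^{1-t}\left|2h\left(b^tG^{1-t}\right)-h(b)\right|dt.$$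
   Context: A function $\varphi:J\to\mathbb{R}$ on an interval $J\subseteq(0,\infty)$ is GA-convex on $J$ if $\varphi(x^{\lambda}y^{1-\lambda})\le\lambda\varphi(x)+(1-\lambda)\varphi(y)$ for all $x,y\in J$ and $\lambda\in[0,1]$. *)

theory Defs
  imports "HOL-Analysis.Analysis"
begin

definition GA_convex_on :: "real set \<Rightarrow> (real \<Rightarrow> real) \<Rightarrow> bool" where
  "GA_convex_on J \<phi> \<longleftrightarrow>
     is_interval J \<and> J \<subseteq> {0<..} \<and>
     (\<forall>x\<in>J. \<forall>y\<in>J. \<forall>l\<in>{0..1}.
        \<phi> (x powr l * y powr (1 - l)) \<le> l * \<phi> x + (1 - l) * \<phi> y)"

definition geo_mean :: "real \<Rightarrow> real \<Rightarrow> real" where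
  "geo_mean a b = sqrt (a * b)"

(* All integrals are Henstock-Kurzweil integrals: the derivative of a merely
   differentiable weight h need not be Lebesgue integrable on [a,b]. *)

definition zeta1 :: "(real \<Rightarrow> real) \<Rightarrow> real \<Rightarrow> real \<Rightarrow> real" where
  "zeta1 h a b = (let G = geo_mean a b in
     integral {0..1} (\<lambda>t. t * (a powr t * G powr (1 - t))
       * \<bar>2 * h (a powr t * G powr (1 - t)) - h b\<bar>))"

definition zeta2 :: "(real \<Rightarrow> real) \<Rightarrow> real \<Rightarrow> real \<Rightarrow> real" where
  "zeta2 h a b = (let G = geo_mean a b in
     integral {0..1} (\<lambda>t. (1 - t) * (a powr t * G powr (1 - t))
       * \<bar>2 * h (a powr t * G powr (1 - t)) - h b\<bar>)
   + integral {0..1} (\<lambda>t. (1 - t) * (b powr t * G powr (1 - t))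
       * \<bar>2 * h (b powr t * G powr (1 - t)) - h b\<bar>))"

definition zeta3 :: "(real \<Rightarrow> real) \<Rightarrow> real \<Rightarrow> real \<Rightarrow> real" where
  "zeta3 h a b = (let G = geo_mean a b in
     integral {0..1} (\<lambda>t. t * (b powr t * G powr (1 - t))
       * \<bar>2 * h (b powr t * G powr (1 - t)) - h b\<bar>))"

end

theory Submission
  imports Defs
begin

text \<open>Integration by parts turns the quantity inside the modulus into half the integral of
  \<open>f' (2 h - h b)\<close>. Split that integral at \<open>G\<close> and substitute \<open>x = a\<^sup>t G\<^sup>1\<^sup>-\<^sup>t\<close> and
  \<open>x = b\<^sup>t G\<^sup>1\<^sup>-\<^sup>t\<close>: both substitutions have logarithmic speed \<open>(ln b - ln a) / 2\<close>, and along
  them GA-convexity of \<open>\<bar>f'\<bar>\<close> gives an affine bound in \<open>t\<close>.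
  GA-convexity also makes \<open>f'\<close> bounded, so \<open>f' h\<close> is absolutely integrable, although \<open>f h'\<close> may
  be integrable only in the Henstock-Kurzweil sense.\<close>

section \<open>Weighted geometric means as a path\<close>

text \<open>In the coordinate \<open>ln x\<close> this is the affine path from \<open>ln q\<close>
  at \<open>t = 0\<close> to \<open>ln p\<close> at \<open>t = 1\<close>. Taking \<open>q\<close> as
  the geometric mean lets both halves of the interval start there.\<close>

definition geo_path :: "real \<Rightarrow> real \<Rightarrow> real \<Rightarrow> real" where
  "geo_path p q t = p powr t * q powr (1 - t)"

lemma geo_path_pos: "0 < p \<Longrightarrow> 0 < q \<Longrightarrow> 0 < geo_path p q t"
  by (simp add: geo_path_def)

lemma geo_path_eq_exp:
  assumes "0 < p" "0 < q"
  shows "geo_path p q t = exp (t * ln p + (1 - t) * ln q)"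
  using assms by (simp add: geo_path_def powr_def exp_add)

lemma has_real_derivative_geo_path:
  assumes "0 < p" "0 < q"
  shows "(geo_path p q has_real_derivative geo_path p q t * (ln p - ln q)) (at t within S)"
proof -
  have "geo_path p q = (\<lambda>t. exp (t * ln p + (1 - t) * ln q))"
    using geo_path_eq_exp[OF assms] by (rule ext)
  then show ?thesis
    by (auto intro!: derivative_eq_intros simp: algebra_simps)
qed

lemma inj_geo_path:
  assumes "0 < p" "0 < q" "p \<noteq> q"
  shows "inj (geo_path p q)"
proof (rule injI)
  fix s t
  assume "geo_path p q s = geo_path p q t"
  then have "(s - t) * (ln p - ln q) = 0"
    using assms by (simp add: geo_path_eq_exp algebra_simps)
  then show "s = t"
    using assms by simp
qed

text \<open>In logarithmic coordinates the path parametrises a segment affinely, and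
  \<open>exp\<close> and \<open>ln\<close> preserve order. The form with
  \<open>closed_segment\<close> covers both orders of \<open>p\<close> and \<open>q\<close>.\<close>

lemma geo_path_image:
  assumes "0 < p" "0 < q"
  shows "geo_path p q ` {0..1} = closed_segment p q"
proof -
  have "geo_path p q ` {0..1} = exp ` (\<lambda>t. (1 - t) *\<^sub>R ln q + t *\<^sub>R ln p) ` {0..1}"
    using assms by (simp add: geo_path_eq_exp image_image algebra_simps)
  also have "\<dots> = exp ` closed_segment (ln q) (ln p)"
    by (simp only: closed_segment_image_interval)
  also have "\<dots> = closed_segment p q"
  proof (intro equalityI subsetI)
    fix x assume "x \<in> exp ` closed_segment (ln q) (ln p)"
    then obtain y where y: "x = exp y" "y \<in> closed_segment (ln q) (ln p)"
      by blast
    have "exp y \<in> closed_segment (exp (ln p)) (exp (ln q))"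
      using y(2) unfolding closed_segment_eq_real_ivl exp_le_cancel_iff by (auto split: if_splits)
    then show "x \<in> closed_segment p q"
      using assms y(1) by simp
  next
    fix x assume x: "x \<in> closed_segment p q"
    then have "0 < x"
      using assms by (auto simp: closed_segment_eq_real_ivl split: if_splits)
    moreover from this x have "ln x \<in> closed_segment (ln q) (ln p)"
      using assms by (auto simp: closed_segment_eq_real_ivl split: if_splits)
    ultimately show "x \<in> exp ` closed_segment (ln q) (ln p)"
      by (intro image_eqI[of _ _ "ln x"]) simp_all
  qed
  finally show ?thesis .
qed

section \<open>GA-convexity along the path and the resulting integral bound\<close>

lemma GA_convex_on_geo_path:
  assumes "GA_convex_on S \<phi>" "p \<in> S" "q \<in> S" "t \<in> {0..1}"
  shows "\<phi> (geo_path p q t) \<le> t * \<phi> p + (1 - t) * \<phi> q"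
  using assms unfolding GA_convex_on_def geo_path_def by blast

text \<open>Each point of the interval lies on the path between the endpoints, where the value is
  bounded by a convex combination of the endpoint values. Applied to \<open>|f'|\<close>, this is
  what makes \<open>f'\<close> bounded.\<close>

lemma GA_convex_on_le_max:
  assumes "GA_convex_on {a..b} \<phi>" "x \<in> {a..b}"
  shows "\<phi> x \<le> max (\<phi> a) (\<phi> b)"
proof -
  have ab: "0 < a" "a \<le> b" "0 < b"
    using assms by (auto simp: GA_convex_on_def subset_eq)
  have "x \<in> geo_path a b ` {0..1}"
    using assms(2) ab by (simp add: geo_path_image closed_segment_eq_real_ivl)
  then obtain t where t: "t \<in> {0..1}" "x = geo_path a b t"
    by blast
  have "\<phi> x \<le> t * \<phi> a + (1 - t) * \<phi> b"
    unfolding t(2) using GA_convex_on_geo_path[OF assms(1) _ _ t(1)] ab by simp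
  also have "\<dots> \<le> max (\<phi> a) (\<phi> b)"
    using t(1) by (intro convex_bound_le) auto
  finally show ?thesis .
qed

text \<open>The path's derivative is the path itself times the constant \<open>ln p - ln q\<close>,
  so in the substitution only the absolute value of that constant leaves the integral; the absolute
  value handles both orientations.\<close>

lemma integral_closed_segment_geo_path:
  assumes "0 < p" "0 < q" "p \<noteq> q" "g absolutely_integrable_on closed_segment p q"
  shows "(\<lambda>t. geo_path p q t * g (geo_path p q t)) integrable_on {0..1}"
    and "integral (closed_segment p q) g
      = \<bar>ln p - ln q\<bar> * integral {0..1} (\<lambda>t. geo_path p q t * g (geo_path p q t))"
proof -
  let ?k = "\<lambda>t. \<bar>geo_path p q t * (ln p - ln q)\<bar> * g (geo_path p q t)"
  have nz: "\<bar>ln p - ln q\<bar> \<noteq> 0"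
    using assms by simp
  have k: "?k = (\<lambda>t. \<bar>ln p - ln q\<bar> * (geo_path p q t * g (geo_path p q t)))"
    using geo_path_pos[OF assms(1,2)] by (simp add: abs_mult abs_of_pos mult_ac)
  \<comment> \<open>The change of variables is an equivalence; it is used from right to left, the
    right side holding because the image of the path is the segment.\<close>
  have "?k absolutely_integrable_on {0..1} \<and> integral {0..1} ?k = integral (closed_segment p q) g
    \<longleftrightarrow> g absolutely_integrable_on (geo_path p q ` {0..1})
      \<and> integral (geo_path p q ` {0..1}) g = integral (closed_segment p q) g"
    using assms
    by (intro has_absolute_integral_change_of_variables_1' has_real_derivative_geo_path
        inj_on_subset[OF inj_geo_path]) auto
  then have *: "?k absolutely_integrable_on {0..1}"
    "integral {0..1} ?k = integral (closed_segment p q) g"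
    using assms by (simp_all add: geo_path_image)
  have "?k integrable_on {0..1}"
    using *(1) by (rule set_lebesgue_integral_eq_integral(1))
  then show "(\<lambda>t. geo_path p q t * g (geo_path p q t)) integrable_on {0..1}"
    unfolding k using nz by simp
  show "integral (closed_segment p q) g
      = \<bar>ln p - ln q\<bar> * integral {0..1} (\<lambda>t. geo_path p q t * g (geo_path p q t))"
    using *(2) unfolding k by simp
qed

text \<open>After the substitution, \<open>\<phi>\<close> is at most an affine function of
  \<open>t\<close>, and multiplying by the nonnegative weight and the positive path preserves this.
  The unordered segment allows one statement to serve both halves of \<open>[a, b]\<close>.\<close>

lemma integral_GA_convex_le:
  assumes "GA_convex_on S \<phi>" "closed_segment p q \<subseteq> S" "p \<noteq> q"
    and int: "(\<lambda>x. \<phi> x * w x) absolutely_integrable_on closed_segment p q"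
    and cont: "continuous_on (closed_segment p q) w"
    and nonneg: "\<And>x. x \<in> closed_segment p q \<Longrightarrow> 0 \<le> w x"
  shows "integral (closed_segment p q) (\<lambda>x. \<phi> x * w x)
    \<le> \<bar>ln p - ln q\<bar> *
       (integral {0..1} (\<lambda>t. t * geo_path p q t * w (geo_path p q t)) * \<phi> p
        + integral {0..1} (\<lambda>t. (1 - t) * geo_path p q t * w (geo_path p q t)) * \<phi> q)"
proof -
  let ?x = "geo_path p q"
  have pq: "p \<in> S" "q \<in> S"
    using assms(2) by auto
  then have pos: "0 < p" "0 < q"
    using assms(1) by (auto simp: GA_convex_on_def)
  have x_in: "?x t \<in> closed_segment p q" if "t \<in> {0..1}" for t
    using that geo_path_image[OF pos] by blast
  have cx: "continuous_on {0..1} ?x"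
    by (rule DERIV_continuous_on) (rule has_real_derivative_geo_path[OF pos])
  have cw: "continuous_on {0..1} (\<lambda>t. w (?x t))"
    using x_in by (intro continuous_on_compose2[OF cont cx]) blast
  have int1: "(\<lambda>t. t * ?x t * w (?x t)) integrable_on {0..1}"
    and int2: "(\<lambda>t. (1 - t) * ?x t * w (?x t)) integrable_on {0..1}"
    by (intro integrable_continuous_real continuous_intros cx cw)+
  have "integral {0..1} (\<lambda>t. ?x t * (\<phi> (?x t) * w (?x t)))
    \<le> integral {0..1} (\<lambda>t. t * ?x t * w (?x t) * \<phi> p + (1 - t) * ?x t * w (?x t) * \<phi> q)"
  proof (rule integral_le)
    show "(\<lambda>t. ?x t * (\<phi> (?x t) * w (?x t))) integrable_on {0..1}"
      by (rule integral_closed_segment_geo_path(1)[OF pos assms(3) int])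
    show "(\<lambda>t. t * ?x t * w (?x t) * \<phi> p + (1 - t) * ?x t * w (?x t) * \<phi> q) integrable_on {0..1}"
      using int1 int2 by (intro integrable_add integrable_on_mult_left)
    fix t :: real
    assume t: "t \<in> {0..1}"
    have "?x t * w (?x t) * \<phi> (?x t) \<le> ?x t * w (?x t) * (t * \<phi> p + (1 - t) * \<phi> q)"
      using GA_convex_on_geo_path[OF assms(1) pq t] geo_path_pos[OF pos] nonneg[OF x_in[OF t]]
      by (intro mult_left_mono) (auto simp: less_imp_le)
    then show "?x t * (\<phi> (?x t) * w (?x t))
        \<le> t * ?x t * w (?x t) * \<phi> p + (1 - t) * ?x t * w (?x t) * \<phi> q"
      by (simp add: algebra_simps)
  qed
  also have "\<dots> = integral {0..1} (\<lambda>t. t * ?x t * w (?x t)) * \<phi> p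
      + integral {0..1} (\<lambda>t. (1 - t) * ?x t * w (?x t)) * \<phi> q"
    using int1 int2 by (simp add: integral_add integrable_on_mult_left)
  finally show ?thesis
    unfolding integral_closed_segment_geo_path(2)[OF pos assms(3) int]
    by (intro mult_left_mono) auto
qed

section \<open>Absolute integrability of bounded derivatives and their weighted products\<close>

text \<open>The fundamental theorem of calculus makes a derivative Henstock-Kurzweil integrable, and
  domination by a constant upgrades this to absolute integrability.\<close>

lemma absolutely_integrable_derivative_bounded:
  fixes f f' :: "real \<Rightarrow> real"
  assumes "a \<le> b"
    and "\<And>x. x \<in> {a..b} \<Longrightarrow> (f has_real_derivative f' x) (at x within {a..b})"
    and "\<And>x. x \<in> {a..b} \<Longrightarrow> \<bar>f' x\<bar> \<le> B"
  shows "f' absolutely_integrable_on {a..b}"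
proof (rule absolutely_integrable_integrable_bound)
  show "f' integrable_on {a..b}"
    using fundamental_theorem_of_calculus[OF assms(1)] assms(2)
    by (auto simp: has_real_derivative_iff_has_vector_derivative integrable_on_def)
  show "norm (f' x) \<le> B" if "x \<in> {a..b}" for x
    using assms(3)[OF that] by simp
  show "(\<lambda>x. B) integrable_on {a..b}"
    by (rule integrable_const_ivl)
qed

lemma absolutely_integrable_mult_continuous:
  fixes u v :: "real \<Rightarrow> real"
  assumes "u absolutely_integrable_on {a..b}" "continuous_on {a..b} v"
  shows "(\<lambda>x. u x * v x) absolutely_integrable_on {a..b}"
proof -
  have "v \<in> borel_measurable (lebesgue_on {a..b})"
    using assms(2) by (intro continuous_imp_measurable_on_sets_lebesgue) auto
  moreover have "bounded (v ` {a..b})"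
    using assms(2) by (intro compact_imp_bounded compact_continuous_image) auto
  ultimately have "(\<lambda>x. v x * u x) absolutely_integrable_on {a..b}"
    using assms(1) by (intro absolutely_integrable_bounded_measurable_product_real) auto
  then show ?thesis
    by (simp add: mult.commute)
qed

theorem theorem5:
  fixes I :: "real set" and f f' h h' :: "real \<Rightarrow> real" and a b :: real
  assumes "is_interval I" and "I \<subseteq> {0<..}"
    and "\<And>x. x \<in> interior I \<Longrightarrow> (f has_real_derivative f' x) (at x)"
    and "a \<in> interior I" and "b \<in> interior I" and "a < b"
    and "\<And>x. x \<in> {a..b} \<Longrightarrow> 0 \<le> h x"
    and "\<And>x. x \<in> {a..b} \<Longrightarrow> (h has_real_derivative h' x) (at x within {a..b})"
    and "GA_convex_on {a..b} (\<lambda>x. \<bar>f' x\<bar>)"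
  shows "\<bar>(h b - 2 * h a) * (f a / 2) + h b * (f b / 2) - integral {a..b} (\<lambda>x. f x * h' x)\<bar>
    \<le> (ln b - ln a) / 4 *
       (zeta1 h a b * \<bar>f' a\<bar> + zeta2 h a b * \<bar>f' (geo_mean a b)\<bar> + zeta3 h a b * \<bar>f' b\<bar>)"
proof -
  define G where "G = geo_mean a b"
  define w where "w x = \<bar>2 * h x - h b\<bar>" for x
  have pos: "0 < a" "0 < b"
    using assms(2,4,5) interior_subset by blast+
  \<comment> \<open>\<open>G\<close> is the midpoint of \<open>[a, b]\<close> on the logarithmic
    scale, so both halves have the same logarithmic length.\<close>
  have lnG: "ln G = (ln a + ln b) / 2" and G0: "0 < G"
    using pos by (simp_all add: G_def geo_mean_def ln_sqrt ln_mult)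
  have "ln a < ln b"
    using pos assms(6) by simp
  then have "ln a < ln G" "ln G < ln b"
    unfolding lnG by simp_all
  then have G: "a < G" "G < b"
    using pos G0 by simp_all
  have "is_interval (interior I)"
    using assms(1) by (simp add: is_interval_convex_1 convex_interior)
  then have "{a..b} \<subseteq> interior I"
    using assms(4,5) mem_is_interval_1_I by (meson atLeastAtMost_iff subsetI)
  then have df: "(f has_real_derivative f' x) (at x within {a..b})" if "x \<in> {a..b}" for x
    using that by (intro has_field_derivative_at_within[OF assms(3)]) blast
  have ch: "continuous_on {a..b} h"
    using assms(8) by (rule DERIV_continuous_on)
  have f'_abs: "f' absolutely_integrable_on {a..b}"
    using assms(6) df GA_convex_on_le_max[OF assms(9)]
    by (intro absolutely_integrable_derivative_bounded) auto
  have f'_int: "(f' has_integral f b - f a) {a..b}"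
    using assms(6) df by (intro fundamental_theorem_of_calculus)
      (auto simp: has_real_derivative_iff_has_vector_derivative)
  have f'h_int: "(\<lambda>x. f' x * h x) integrable_on {a..b}"
    using absolutely_integrable_mult_continuous[OF f'_abs ch]
    by (rule set_lebesgue_integral_eq_integral(1))
  have parts: "((\<lambda>x. f' x * h x + f x * h' x) has_integral f b * h b - f a * h a) {a..b}"
  proof (rule fundamental_theorem_of_calculus)
    show "((\<lambda>x. f x * h x) has_vector_derivative f' x * h x + f x * h' x) (at x within {a..b})"
      if "x \<in> {a..b}" for x
      using DERIV_mult[OF df[OF that] assms(8)[OF that]]
      by (simp add: has_real_derivative_iff_has_vector_derivative algebra_simps)
  qed (use assms(6) in simp)
  \<comment> \<open>Integrability of \<open>f h'\<close> comes by subtraction: the product rule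
    makes the sum integrable, and \<open>f' h\<close> is integrable by boundedness of
    \<open>f'\<close> and continuity of \<open>h\<close>.\<close>
  have "((\<lambda>x. f x * h' x) has_integral
      f b * h b - f a * h a - integral {a..b} (\<lambda>x. f' x * h x)) {a..b}"
    using has_integral_diff[OF parts integrable_integral[OF f'h_int]] by simp
  then have fh': "integral {a..b} (\<lambda>x. f x * h' x)
      = f b * h b - f a * h a - integral {a..b} (\<lambda>x. f' x * h x)"
    by (rule integral_unique)
  \<comment> \<open>Subtracting \<open>h b * f'\<close> contributes
    \<open>- h b * (f b - f a)\<close>, which turns twice the boundary term of the integration by
    parts into twice the endpoint terms of the claim.\<close>
  have "((\<lambda>x. 2 * (f' x * h x) - h b * f' x) has_integral
      2 * integral {a..b} (\<lambda>x. f' x * h x) - h b * (f b - f a)) {a..b}"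
    by (intro has_integral_diff has_integral_mult_right integrable_integral[OF f'h_int] f'_int)
  then have key: "((\<lambda>x. f' x * (2 * h x - h b)) has_integral
      2 * ((h b - 2 * h a) * (f a / 2) + h b * (f b / 2) - integral {a..b} (\<lambda>x. f x * h' x))) {a..b}"
    unfolding fh' by (simp add: algebra_simps)
  have cw: "continuous_on {a..b} w"
    unfolding w_def by (intro continuous_intros ch)
  have abs_int: "(\<lambda>x. \<bar>f' x\<bar> * w x) absolutely_integrable_on {a..b}"
    using absolutely_integrable_norm[OF f'_abs]
    by (intro absolutely_integrable_mult_continuous cw) (simp add: comp_def)
  then have int: "(\<lambda>x. \<bar>f' x\<bar> * w x) integrable_on {a..b}"
    by (rule set_lebesgue_integral_eq_integral(1))
  \<comment> \<open>\<open>G\<close> is the second endpoint both times, so the affine bounds put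
    \<open>t\<close> on \<open>|f' a|\<close> or \<open>|f' b|\<close> and \<open>1 - t\<close> on
    \<open>|f' G|\<close>, as in the zetas.\<close>
  have seg: "closed_segment a G = {a..G}" "closed_segment b G = {G..b}"
    using G by (simp_all add: closed_segment_eq_real_ivl)
  have left: "integral {a..G} (\<lambda>x. \<bar>f' x\<bar> * w x) \<le> \<bar>ln a - ln G\<bar> *
       (integral {0..1} (\<lambda>t. t * geo_path a G t * w (geo_path a G t)) * \<bar>f' a\<bar>
        + integral {0..1} (\<lambda>t. (1 - t) * geo_path a G t * w (geo_path a G t)) * \<bar>f' G\<bar>)"
    using G integral_GA_convex_le[OF assms(9), of a G w, unfolded seg]
      absolutely_integrable_on_subinterval[OF abs_int] continuous_on_subset[OF cw]
    by (simp add: w_def)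
  have right: "integral {G..b} (\<lambda>x. \<bar>f' x\<bar> * w x) \<le> \<bar>ln b - ln G\<bar> *
       (integral {0..1} (\<lambda>t. t * geo_path b G t * w (geo_path b G t)) * \<bar>f' b\<bar>
        + integral {0..1} (\<lambda>t. (1 - t) * geo_path b G t * w (geo_path b G t)) * \<bar>f' G\<bar>)"
    using G integral_GA_convex_le[OF assms(9), of b G w, unfolded seg]
      absolutely_integrable_on_subinterval[OF abs_int] continuous_on_subset[OF cw]
    by (simp add: w_def)
  have ln_half: "\<bar>ln a - ln G\<bar> = (ln b - ln a) / 2" "\<bar>ln b - ln G\<bar> = (ln b - ln a) / 2"
    unfolding lnG using \<open>ln a < ln b\<close> by (simp_all add: abs_if field_simps)
  have zetas:
    "zeta1 h a b = integral {0..1} (\<lambda>t. t * geo_path a G t * w (geo_path a G t))"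
    "zeta2 h a b = integral {0..1} (\<lambda>t. (1 - t) * geo_path a G t * w (geo_path a G t))
      + integral {0..1} (\<lambda>t. (1 - t) * geo_path b G t * w (geo_path b G t))"
    "zeta3 h a b = integral {0..1} (\<lambda>t. t * geo_path b G t * w (geo_path b G t))"
    by (simp_all add: zeta1_def zeta2_def zeta3_def Let_def G_def geo_path_def w_def)
  \<comment> \<open>Here \<open>c\<close> stands for \<open>ln b - ln a\<close>. The factor
    \<open>c / 2\<close> of each half is twice the claimed \<open>c / 4\<close>, and the two
    coefficients \<open>B\<close> and \<open>D\<close> of \<open>|f' G|\<close> add up to
    \<open>zeta2\<close>.\<close>
  have combine: "L + R \<le> 2 * (c / 4 * (A * u + (B + D) * v + C * z))"
    if "L \<le> c / 2 * (A * u + B * v)" "R \<le> c / 2 * (C * z + D * v)"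
    for L R c A B C D u v z :: real
    using that by (simp add: algebra_simps)
  have "2 * \<bar>(h b - 2 * h a) * (f a / 2) + h b * (f b / 2) - integral {a..b} (\<lambda>x. f x * h' x)\<bar>
      = norm (integral {a..b} (\<lambda>x. f' x * (2 * h x - h b)))"
    unfolding integral_unique[OF key] real_norm_def abs_mult by (simp only: abs_numeral)
  \<comment> \<open>The triangle inequality for integrals applies because the dominating function
    \<open>|f'| * w\<close> is integrable as well.\<close>
  also have "\<dots> \<le> integral {a..b} (\<lambda>x. \<bar>f' x\<bar> * w x)"
    using key int by (intro integral_norm_bound_integral) (auto simp: w_def abs_mult)
  also have "\<dots> = integral {a..G} (\<lambda>x. \<bar>f' x\<bar> * w x) + integral {G..b} (\<lambda>x. \<bar>f' x\<bar> * w x)"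
    using G int by (simp add: Henstock_Kurzweil_Integration.integral_combine)
  also have "\<dots> \<le> 2 * ((ln b - ln a) / 4 *
       (zeta1 h a b * \<bar>f' a\<bar> + zeta2 h a b * \<bar>f' G\<bar> + zeta3 h a b * \<bar>f' b\<bar>))"
    unfolding zetas by (rule combine[OF left[unfolded ln_half] right[unfolded ln_half]])
  finally show ?thesis
    by (simp add: G_def)
qed

end
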